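(* Let $(\sigma,\tau_0,\tau_1)$ be any triple in the class of $(e,e,(23))$, of $(e,e,(132))$, or of $(e,(23),(132))$. Then for every infinite sequence $(i_1,i_2,\ldots)\in\{0,1\}^{\mathbb{N}}$, $\bigcap_{n}\Gamma_{(\sigma,\tau_0,\tau_1)}(i_1,\ldots,i_n)$ is a single point; in particular $\Phi(\sigma,\tau_0,\tau_1)$ is a function.
   Context: Let $\triangle=\{(x,y):1>x>y>0\}$, $\pi(x,y,z)=(y/x,z/x)$, and for a $3\times3$ matrix $M$ with nonzero first-row entries $\pi(M)$ is the closed triangle with vertices the $\pi$-images of the columns of $M$ (in column order). $V=\begin{pmatrix}1&1&1\\0&1&1\\0&0&1\end{pmatrix}$, $F_0=\begin{pmatrix}0&0&1\\1&0&0\\0&1&1\end{pmatrix}$, $F_1=\begin{pmatrix}1&0&1\\0&1&0\\0&0&1\end{pmatrix}$, $G_0=\begin{pmatrix}0&0&1/2\\1&0&0\\0&1&1/2\end{pmatrix}$, $G_1=\begin{pmatrix}1&0&1/2\\0&1&0\\0&0&1/2\end{pmatrix}$. Elements of $S_3$ are permutation matrices: $e=I$, $(12)=\begin{pmatrix}0&1&0\\1&0&0\\0&0&1\end{pmatrix}$, $(13)=\begin{pmatrix}0&0&1\\0&1&0\\1&0&0\end{pmatrix}$, $(23)=\begin{pmatrix}1&0&0\\0&0&1\\0&1&0\end{pmatrix}$, $(123)=\begin{pmatrix}0&1&0\\0&0&1\\1&0&0\end{pmatrix}$, $(132)=\begin{pmatrix}0&0&1\\1&0&0\\0&1&0\end{pmatrix}$.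 For $(\sigma,\tau_0,\tau_1)\in S_3^3$: $F_i(\sigma,\tau_0,\tau_1)=\sigma F_i\tau_i$, $G_i(\sigma,\tau_0,\tau_1)=\sigma G_i\tau_i$, $\triangle_{(\sigma,\tau_0,\tau_1)}(i_1,\ldots,i_n)=\pi(VF_{i_1}(\sigma,\tau_0,\tau_1)\cdots F_{i_n}(\sigma,\tau_0,\tau_1))$, $\Gamma_{(\sigma,\tau_0,\tau_1)}(i_1,\ldots,i_n)=\pi(VG_{i_1}(\sigma,\tau_0,\tau_1)\cdots G_{i_n}(\sigma,\tau_0,\tau_1))$. The class of a triple is the smallest subset of $S_3^3$ containing it and closed under the operations $(\sigma,\tau_0,\tau_1)\mapsto(\sigma(13),(12)\tau_1,(12)\tau_0)$ and $(\sigma,\tau_0,\tau_1)\mapsto(\rho\sigma,\tau_0\rho^{-1},\tau_1\rho^{-1})$ for $\rho\in S_3$. The relation $\Phi(\sigma,\tau_0,\tau_1)$ on $\triangle$: if $(x,y)$ lies in the interior of $\triangle_{(\sigma,\tau_0,\tau_1)}(i_1,\ldots,i_n)$ for all $n$, then $\Phi(\sigma,\tau_0,\tau_1)(x,y)=\bigcap_n\Gamma_{(\sigma,\tau_0,\tau_1)}(i_1,\ldots,i_n)$; if $(x,y)$ lies on the boundary of some $\triangle_{(\sigma,\tau_0,\tau_1)}(i_1,\ldots,i_n)$, its image is given by the affine map sending the vertices of that triangle to the corresponding vertices of $\Gamma_{(\sigma,\tau_0,\tau_1)}(i_1,\ldots,i_n)$. $\Phi$ is a function if every image is a single point.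
   Formalization: In the definition of Φ, a boundary point's image uses the affine map of a triangle of the first level n at which the point lies on a boundary; with "some triangle" of any level the maps disagree, e.g. (2/3,1/3) for (e,e,(23)) gets both (2/3,1/3) and (3/4,1/4). *)

theory Defs
  imports "HOL-Analysis.Analysis"
begin

type_synonym mat3 = "real^3^3"
type_synonym triple = "mat3 \<times> mat3 \<times> mat3"

text \<open>Matrices are entered by rows.\<close>

definition mat3_of_rows :: "real list list \<Rightarrow> mat3" where
  "mat3_of_rows rs = vector (map vector rs)"

definition V :: mat3 where
  "V = mat3_of_rows [[1,1,1],[0,1,1],[0,0,1]]"

definition F0 :: mat3 where
  "F0 = mat3_of_rows [[0,0,1],[1,0,0],[0,1,1]]"

definition F1 :: mat3 where
  "F1 = mat3_of_rows [[1,0,1],[0,1,0],[0,0,1]]"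

definition G0 :: mat3 where
  "G0 = mat3_of_rows [[0,0,1/2],[1,0,0],[0,1,1/2]]"

definition G1 :: mat3 where
  "G1 = mat3_of_rows [[1,0,1/2],[0,1,0],[0,0,1/2]]"

definition p_e :: mat3 where
  "p_e = mat 1"

definition p12 :: mat3 where
  "p12 = mat3_of_rows [[0,1,0],[1,0,0],[0,0,1]]"

definition p13 :: mat3 where
  "p13 = mat3_of_rows [[0,0,1],[0,1,0],[1,0,0]]"

definition p23 :: mat3 where
  "p23 = mat3_of_rows [[1,0,0],[0,0,1],[0,1,0]]"

definition p123 :: mat3 where
  "p123 = mat3_of_rows [[0,1,0],[0,0,1],[1,0,0]]"

definition p132 :: mat3 where
  "p132 = mat3_of_rows [[0,0,1],[1,0,0],[0,1,0]]"

definition S3 :: "mat3 set" where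
  "S3 = {p_e, p12, p13, p23, p123, p132}"

inductive_set trip_class :: "triple \<Rightarrow> triple set" for t :: triple where
  base: "t \<in> trip_class t"
| swap: "(\<sigma>, \<tau>0, \<tau>1) \<in> trip_class t \<Longrightarrow>
    (\<sigma> ** p13, p12 ** \<tau>1, p12 ** \<tau>0) \<in> trip_class t"
| conj: "(\<sigma>, \<tau>0, \<tau>1) \<in> trip_class t \<Longrightarrow> \<rho> \<in> S3 \<Longrightarrow>
    (\<rho> ** \<sigma>, \<tau>0 ** matrix_inv \<rho>, \<tau>1 ** matrix_inv \<rho>) \<in> trip_class t"

text \<open>A digit in \<open>{0,1}\<close> is a boolean, with \<open>False\<close> for 0 and \<open>True\<close> for 1.\<close>

fun F_trip :: "triple \<Rightarrow> bool \<Rightarrow> mat3" where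
  "F_trip (\<sigma>, \<tau>0, \<tau>1) i = (if i then \<sigma> ** F1 ** \<tau>1 else \<sigma> ** F0 ** \<tau>0)"

fun G_trip :: "triple \<Rightarrow> bool \<Rightarrow> mat3" where
  "G_trip (\<sigma>, \<tau>0, \<tau>1) i = (if i then \<sigma> ** G1 ** \<tau>1 else \<sigma> ** G0 ** \<tau>0)"

definition F_prod :: "triple \<Rightarrow> bool list \<Rightarrow> mat3" where
  "F_prod t w = foldl (\<lambda>M i. M ** F_trip t i) V w"

definition G_prod :: "triple \<Rightarrow> bool list \<Rightarrow> mat3" where
  "G_prod t w = foldl (\<lambda>M i. M ** G_trip t i) V w"

definition proj :: "real^3 \<Rightarrow> real \<times> real" where
  "proj v = (v$2 / v$1, v$3 / v$1)"

definition vertex :: "mat3 \<Rightarrow> 3 \<Rightarrow> real \<times> real" where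
  "vertex M j = proj (column j M)"

definition proj_triangle :: "mat3 \<Rightarrow> (real \<times> real) set" where
  "proj_triangle M = convex hull (range (vertex M))"

definition Tri :: "triple \<Rightarrow> bool list \<Rightarrow> (real \<times> real) set" where
  "Tri t w = proj_triangle (F_prod t w)"

definition Gam :: "triple \<Rightarrow> bool list \<Rightarrow> (real \<times> real) set" where
  "Gam t w = proj_triangle (G_prod t w)"

definition prefix_word :: "(nat \<Rightarrow> bool) \<Rightarrow> nat \<Rightarrow> bool list" where
  "prefix_word i n = map i [0..<n]"

definition Gam_limit :: "triple \<Rightarrow> (nat \<Rightarrow> bool) \<Rightarrow> (real \<times> real) set" where
  "Gam_limit t i = (\<Inter>n\<in>{1..}. Gam t (prefix_word i n))"

definition open_triangle :: "(real \<times> real) set" where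
  "open_triangle = {(x, y). 1 > x \<and> x > y \<and> y > 0}"

definition affine_map :: "(real \<times> real \<Rightarrow> real \<times> real) \<Rightarrow> bool" where
  "affine_map f \<longleftrightarrow> (\<exists>L c. linear L \<and> (\<forall>x. f x = L x + c))"

text \<open>
  In the second clause the triangle is one of the first level at which \<open>p\<close> meets a
  boundary. A point on the boundary of one triangle also lies on boundaries at all later
  levels, and once the edge carrying it has been subdivided the corresponding affine maps
  disagree: \<open>F0\<close> and \<open>F1\<close> split an edge at a mediant, \<open>G0\<close> and \<open>G1\<close> at the midpoint. So
  without this condition the clause would assign several values to one point.
\<close>

definition Phi :: "triple \<Rightarrow> ((real \<times> real) \<times> (real \<times> real)) set" where
  "Phi t = {(p, q). p \<in> open_triangle \<and>
     ((\<exists>i. (\<forall>n\<ge>1. p \<in> interior (Tri t (prefix_word i n))) \<and> q \<in> Gam_limit t i) \<or>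
      (\<exists>w f. p \<in> frontier (Tri t w) \<and>
         (\<forall>w'. length w' < length w \<longrightarrow> p \<notin> frontier (Tri t w')) \<and>
         affine_map f \<and>
         (\<forall>j. f (vertex (F_prod t w) j) = vertex (G_prod t w) j) \<and>
         q = f p))}"

definition Phi_is_function :: "triple \<Rightarrow> bool" where
  "Phi_is_function t \<longleftrightarrow> (\<forall>p\<in>open_triangle. \<exists>q. Phi t `` {p} = {q})"

end

theory Submission
  imports Defs
begin

text \<open>
  Each step splits a triangle \<open>a b c\<close> along the segment from \<open>b\<close> to a point \<open>m\<close> of the edge \<open>a c\<close>.
  For the \<open>G\<close>-matrices \<open>m\<close> is the midpoint, so of the edges of a child one is an old edge, one is half
  of an old edge, and one is a median, of length at most the mean of two old edges. For the three
  representatives every word of length five thereby shortens the longest edge by a uniform factor;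
  this is invariant under both operations generating a class, and the nested triangles shrink to a
  point. For the \<open>F\<close>-matrices, triangles of equal level have disjoint interiors and siblings meet
  only in the segment \<open>b m\<close>. So a point off all boundaries has a unique address, and one that
  first reaches a boundary at level \<open>n\<close> lies in one triangle of that level or on the segment between two
  siblings, where the two affine maps agree because they agree at \<open>b\<close> and \<open>m\<close>.
\<close>

section \<open>Splitting a planar triangle\<close>

text \<open>Dividing by a nonzero coefficient writes its point as an affine combination of the other
  two; \<open>aux\<close> treats the first position, the rest is permutation.\<close>

lemma collinear_if_affine_relation:
  fixes a b c :: "'a::real_vector"
  assumes "x + y + z = 0" "x *\<^sub>R a + y *\<^sub>R b + z *\<^sub>R c = 0" "x \<noteq> 0 \<or> y \<noteq> 0 \<or> z \<noteq> 0"
  shows "collinear {a, b, c}"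
proof -
  have aux: "collinear {a, b, c}"
    if "x + y + z = 0" "x *\<^sub>R a + y *\<^sub>R b + z *\<^sub>R c = 0" "x \<noteq> 0"
    for x y z and a b c :: 'a
  proof -
    have z: "z = - x - y" using that by simp
    have "x *\<^sub>R a = (- y) *\<^sub>R b + (x + y) *\<^sub>R c"
      using that(2) unfolding z by (simp add: algebra_simps)
    with that(3) have "x *\<^sub>R a = x *\<^sub>R ((- y / x) *\<^sub>R b + (1 - (- y / x)) *\<^sub>R c)"
      by (simp add: algebra_simps)
    then have "a = (- y / x) *\<^sub>R b + (1 - (- y / x)) *\<^sub>R c"
      using that(3) by (metis scaleR_cancel_left)
    then have "collinear {b, a, c}" unfolding collinear_3_expand by blast
    then show ?thesis by (simp add: insert_commute)
  qed
  consider "x \<noteq> 0" | "y \<noteq> 0" | "z \<noteq> 0" using assms(3) by blast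
  then show ?thesis
  proof cases
    case 1
    then show ?thesis using aux assms by blast
  next
    case 2
    then have "collinear {b, a, c}"
      using aux[of y x z b a c] assms by (simp add: algebra_simps)
    then show ?thesis by (simp add: insert_commute)
  next
    case 3
    then have "collinear {c, a, b}"
      using aux[of z x y c a b] assms by (simp add: algebra_simps)
    then show ?thesis by (simp add: insert_commute)
  qed
qed

lemma barycentric_unique:
  fixes a b c :: "'a::real_vector"
  assumes "\<not> collinear {a, b, c}"
    and "u *\<^sub>R a + v *\<^sub>R b + w *\<^sub>R c = u' *\<^sub>R a + v' *\<^sub>R b + w' *\<^sub>R c"
    and "u + v + w = u' + v' + w'"
  shows "u = u' \<and> v = v' \<and> w = w'"
proof (rule ccontr)
  assume "\<not> ?thesis"
  then have "u - u' \<noteq> 0 \<or> v - v' \<noteq> 0 \<or> w - w' \<noteq> 0" by simp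
  moreover have "(u - u') *\<^sub>R a + (v - v') *\<^sub>R b + (w - w') *\<^sub>R c = 0"
    using assms(2) by (simp add: algebra_simps)
  moreover have "(u - u') + (v - v') + (w - w') = 0"
    using assms(3) by simp
  ultimately show False
    using collinear_if_affine_relation assms(1) by blast
qed

text \<open>The ratio \<open>s\<close> stays free because mediants cut edges in varying ratios. The
  predicate takes only \<open>a c m s\<close>; the opposite vertex \<open>b\<close> is supplied at
  each use.\<close>

locale split_triangle =
  fixes a b c m :: "real \<times> real" and s :: real
  assumes s: "0 < s" "s < 1" and m: "m = (1 - s) *\<^sub>R a + s *\<^sub>R c"
begin

lemma halves_subset:
  "convex hull {b, c, m} \<subseteq> convex hull {a, b, c}"
  "convex hull {a, b, m} \<subseteq> convex hull {a, b, c}"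
proof -
  have "m \<in> convex hull {a, b, c}"
    unfolding convex_hull_3 mem_Collect_eq m
    using s by (intro exI[of _ "1 - s"] exI[of _ 0] exI[of _ s]) simp
  moreover have "{a, b, c} \<subseteq> convex hull {a, b, c}" by (rule hull_subset)
  ultimately show
    "convex hull {b, c, m} \<subseteq> convex hull {a, b, c}"
    "convex hull {a, b, m} \<subseteq> convex hull {a, b, c}"
    by (meson convex_convex_hull hull_minimal insert_subset empty_subsetI)+
qed

lemma halves_cover:
  "convex hull {a, b, c} \<subseteq> convex hull {b, c, m} \<union> convex hull {a, b, m}"
proof
  fix p assume "p \<in> convex hull {a, b, c}"
  then obtain u v w where uvw: "0 \<le> u" "0 \<le> v" "0 \<le> w" "u + v + w = 1"
    and p: "p = u *\<^sub>R a + v *\<^sub>R b + w *\<^sub>R c"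
    unfolding convex_hull_3 by blast
  show "p \<in> convex hull {b, c, m} \<union> convex hull {a, b, m}"
  \<comment> \<open>The line through \<open>b\<close> and \<open>m\<close> is
    \<open>u * s = w * (1 - s)\<close>. On the side of \<open>c\<close>, replacing \<open>a\<close>
    by \<open>m\<close> uses up \<open>\<mu> * s\<close> of the weight of \<open>c\<close>, which
    suffices; the other side is symmetric.\<close>
  proof (cases "u * s \<le> w * (1 - s)")
    case True
    define \<mu> where "\<mu> = u / (1 - s)"
    have \<mu>: "\<mu> * (1 - s) = u" "0 \<le> \<mu>" using s uvw by (auto simp: \<mu>_def)
    have "\<mu> * s \<le> w" using True s by (simp add: \<mu>_def field_simps)
    moreover have "p = v *\<^sub>R b + (w - \<mu> * s) *\<^sub>R c + \<mu> *\<^sub>R m"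
      unfolding p m \<mu>(1)[symmetric] by (simp add: algebra_simps)
    moreover have "v + (w - \<mu> * s) + \<mu> = 1"
      using \<mu>(1) uvw(4) by (simp add: algebra_simps)
    ultimately have "p \<in> convex hull {b, c, m}"
      unfolding convex_hull_3 using uvw \<mu> by fastforce
    then show ?thesis by blast
  next
    case False
    define \<mu> where "\<mu> = w / s"
    have \<mu>: "\<mu> * s = w" "0 \<le> \<mu>" using s uvw by (auto simp: \<mu>_def)
    have "\<mu> * (1 - s) \<le> u" using False s by (simp add: \<mu>_def field_simps)
    moreover have "p = (u - \<mu> * (1 - s)) *\<^sub>R a + v *\<^sub>R b + \<mu> *\<^sub>R m"
      unfolding p m \<mu>(1)[symmetric] by (simp add: algebra_simps)
    moreover have "(u - \<mu> * (1 - s)) + v + \<mu> = 1"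
      using \<mu>(1) uvw(4) by (simp add: algebra_simps)
    ultimately have "p \<in> convex hull {a, b, m}"
      unfolding convex_hull_3 using uvw \<mu> by fastforce
    then show ?thesis by blast
  qed
qed

lemma halves_Int:
  assumes "\<not> collinear {a, b, c}"
  shows "convex hull {b, c, m} \<inter> convex hull {a, b, m} \<subseteq> closed_segment b m"
proof
  fix p assume p: "p \<in> convex hull {b, c, m} \<inter> convex hull {a, b, m}"
  then obtain v w \<mu> where 1: "0 \<le> v" "0 \<le> w" "0 \<le> \<mu>" "v + w + \<mu> = 1"
    and p1: "p = v *\<^sub>R b + w *\<^sub>R c + \<mu> *\<^sub>R m"
    unfolding convex_hull_3 by blast
  obtain u v' \<mu>' where 2: "0 \<le> u" "0 \<le> v'" "0 \<le> \<mu>'" "u + v' + \<mu>' = 1"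
    and p2: "p = u *\<^sub>R a + v' *\<^sub>R b + \<mu>' *\<^sub>R m"
    using p unfolding convex_hull_3 by blast
  have "(\<mu> * (1 - s)) *\<^sub>R a + v *\<^sub>R b + (w + \<mu> * s) *\<^sub>R c
      = (u + \<mu>' * (1 - s)) *\<^sub>R a + v' *\<^sub>R b + (\<mu>' * s) *\<^sub>R c"
    using p1 p2 unfolding m by (simp add: algebra_simps)
  moreover have "\<mu> * (1 - s) + v + (w + \<mu> * s) = (u + \<mu>' * (1 - s)) + v' + \<mu>' * s"
    using 1(4) 2(4) by (simp add: algebra_simps)
  \<comment> \<open>The coordinates at \<open>a\<close> and \<open>c\<close> bound the two weights
    of \<open>m\<close> by each other; so they are equal and \<open>c\<close> keeps no
    weight.\<close>
  ultimately have eq: "\<mu> * (1 - s) = u + \<mu>' * (1 - s)" "w + \<mu> * s = \<mu>' * s"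
    using barycentric_unique[OF assms] by blast+
  have "\<mu>' * (1 - s) \<le> \<mu> * (1 - s)" using eq(1) 2 by simp
  then have "\<mu>' \<le> \<mu>" using s by simp
  moreover have "\<mu> * s \<le> \<mu>' * s" using eq(2) 1 by linarith
  then have "\<mu> \<le> \<mu>'" using s by simp
  ultimately have "w = 0" using eq(2) by simp
  with p1 1 show "p \<in> closed_segment b m"
    unfolding in_segment by (intro exI[of _ \<mu>]) auto
qed

text \<open>\<open>m\<close> lies on the line \<open>a c\<close> but differs from both ends, so
  collinearity of a half would pass to \<open>a, b, c\<close>.\<close>

lemma halves_not_collinear:
  assumes "\<not> collinear {a, b, c}"
  shows "\<not> collinear {b, c, m}" "\<not> collinear {a, b, m}"
proof -
  have "a \<noteq> c" using assms by (auto simp: insert_commute)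
  have "(1 - s) *\<^sub>R a - (1 - s) *\<^sub>R c = m - c" "s *\<^sub>R a - s *\<^sub>R c = a - m"
    unfolding m by (simp_all add: algebra_simps)
  then have "c \<noteq> m" "a \<noteq> m" using s \<open>a \<noteq> c\<close>
    by (metis diff_gt_0_iff_gt eq_iff_diff_eq_0 less_irrefl real_vector.scale_cancel_left)+
  have col: "collinear {c, m, a}"
    by (rule collinear_if_affine_relation[where x = "s" and y = "-1" and z = "1 - s"])
      (auto simp: m algebra_simps)
  show "\<not> collinear {b, c, m}"
    using collinear_3_trans[OF _ col \<open>c \<noteq> m\<close>] assms by (metis insert_commute)
  have col: "collinear {a, m, c}"
    using col by (simp add: insert_commute)
  show "\<not> collinear {a, b, m}"
    using collinear_3_trans[of b a m c] col \<open>a \<noteq> m\<close> assms by (auto simp: insert_commute)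
qed

text \<open>The common part lies in a segment, which has no interior in dimension two.\<close>

lemma halves_interior_disjoint:
  assumes "\<not> collinear {a, b, c}"
  shows "interior (convex hull {b, c, m}) \<inter> interior (convex hull {a, b, m}) = {}"
  using interior_mono[OF halves_Int[OF assms]] interior_closed_segment_ge2[of b m]
  by (simp add: interior_Int)

end

section \<open>Interior points and affine maps of a nondegenerate triangle\<close>

lemma triangle_interior_nonempty:
  fixes a b c :: "real \<times> real"
  assumes "\<not> collinear {a, b, c}"
  shows "interior (convex hull {a, b, c}) \<noteq> {}"
proof -
  have "(1/3) *\<^sub>R a + (1/3) *\<^sub>R b + (1/3) *\<^sub>R c \<in> interior (convex hull {a, b, c})"
    by (subst interior_convex_hull_3_minimal[OF assms])
      (auto intro!: exI[of _ "1/3 :: real"])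
  then show ?thesis by blast
qed

lemma affine_map_combination:
  assumes "affine_map f" "u + v + w = 1"
  shows "f (u *\<^sub>R a + v *\<^sub>R b + w *\<^sub>R c) = u *\<^sub>R f a + v *\<^sub>R f b + w *\<^sub>R f c"
proof -
  obtain L d where L: "linear L" and f: "\<And>x. f x = L x + d"
    using assms(1) unfolding affine_map_def by blast
  have "d = u *\<^sub>R d + v *\<^sub>R d + w *\<^sub>R d"
    using assms(2) by (metis scaleR_add_left scaleR_one)
  then show ?thesis
    using L by (simp add: f linear_add linear_scale scaleR_add_right)
qed

lemma affine_map_exists:
  assumes "\<not> collinear {a, b, c}"
  obtains f where "affine_map f" "f a = a'" "f b = b'" "f c = c'"
proof -
  have ind: "independent {b - a, c - a}"
  proof (rule ccontr)
    assume "\<not> ?thesis"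
    moreover have "b \<noteq> a" "c \<noteq> a" using assms by (auto simp: insert_commute)
    ultimately obtain k where "b - a = k *\<^sub>R (c - a)"
      by (auto simp: independent_insert span_breakdown_eq split: if_splits)
    then have "(k - 1) *\<^sub>R a + 1 *\<^sub>R b + (- k) *\<^sub>R c = 0" by (simp add: algebra_simps)
    then have "collinear {a, b, c}"
      by (intro collinear_if_affine_relation[of "k - 1" 1 "- k"]) auto
    with assms show False by blast
  qed
  have "b \<noteq> c" using assms by (auto simp: insert_commute)
  \<comment> \<open>The images of the two edge vectors are prescribed; \<open>b \<noteq> c\<close>
    keeps the two cases apart.\<close>
  from linear_independent_extend[OF ind, of "\<lambda>x. if x = b - a then b' - a' else c' - a'"]
  obtain L where L: "linear L" "L (b - a) = b' - a'" "L (c - a) = c' - a'"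
    using \<open>b \<noteq> c\<close> by auto
  show ?thesis
  proof (rule that[of "\<lambda>x. L x + (a' - L a)"])
    show "affine_map (\<lambda>x. L x + (a' - L a))" unfolding affine_map_def using L(1) by blast
  qed (use L in \<open>auto simp: linear_diff algebra_simps\<close>)
qed

section \<open>Columns and vertices\<close>

lemma column_mult: "column j (M ** P) = M *v column j (P :: real^'n^'m)"
  by (simp add: column_def matrix_matrix_mult_def matrix_vector_mult_def vec_eq_iff)

lemma columns_eqI: "(\<And>j. column j M = column j N) \<Longrightarrow> M = N"
  by (simp add: column_def vec_eq_iff)

text \<open>Encoded by the action on columns: closure under products and inverses then needs no
  inspection of the six matrices.\<close>

definition permutes_columns :: "mat3 \<Rightarrow> bool" where
  "permutes_columns P \<longleftrightarrow>
     (\<exists>\<pi>. bij \<pi> \<and> (\<forall>M :: mat3. \<forall>j. column j (M ** P) = column (\<pi> j) M))"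

lemma permutes_columnsI:
  assumes "column 1 P = axis x 1" "column 2 P = axis y 1" "column 3 P = axis z 1"
    and "x \<noteq> y" "x \<noteq> z" "y \<noteq> z"
  shows "permutes_columns P"
proof -
  define \<pi> :: "3 \<Rightarrow> 3" where "\<pi> j = (if j = 1 then x else if j = 2 then y else z)" for j
  have "inj \<pi>"
    unfolding inj_def forall_3 \<pi>_def using assms(4-6) by auto
  then have "bij \<pi>" by (simp add: bij_def finite_UNIV_inj_surj)
  moreover have "\<forall>j. column j P = axis (\<pi> j) 1"
    unfolding forall_3 \<pi>_def using assms by auto
  ultimately show ?thesis
    unfolding permutes_columns_def column_mult by (metis matrix_vector_mult_basis)
qed

lemmas perm_defs = p_e_def p12_def p13_def p23_def p123_def p132_def mat3_of_rows_def

lemma column_perms [simp]: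
  "column 1 p_e = axis 1 1" "column 2 p_e = axis 2 1" "column 3 p_e = axis 3 1"
  "column 1 p12 = axis 2 1" "column 2 p12 = axis 1 1" "column 3 p12 = axis 3 1"
  "column 1 p13 = axis 3 1" "column 2 p13 = axis 2 1" "column 3 p13 = axis 1 1"
  "column 1 p23 = axis 1 1" "column 2 p23 = axis 3 1" "column 3 p23 = axis 2 1"
  "column 1 p123 = axis 3 1" "column 2 p123 = axis 1 1" "column 3 p123 = axis 2 1"
  "column 1 p132 = axis 2 1" "column 2 p132 = axis 3 1" "column 3 p132 = axis 1 1"
  by (simp_all add: perm_defs column_def vec_eq_iff forall_3 axis_def mat_def)

lemma S3_permutes_columns: "P \<in> S3 \<Longrightarrow> permutes_columns P"
  unfolding S3_def by (auto intro: permutes_columnsI)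

lemma permutes_columns_mult:
  assumes "permutes_columns P" "permutes_columns Q"
  shows "permutes_columns (P ** Q)"
proof -
  obtain \<pi> \<rho> where "bij \<pi>" "\<And>M :: mat3. \<And>j. column j (M ** P) = column (\<pi> j) M"
    and "bij \<rho>" "\<And>M :: mat3. \<And>j. column j (M ** Q) = column (\<rho> j) M"
    using assms unfolding permutes_columns_def by blast
  then show ?thesis
    unfolding permutes_columns_def
    by (intro exI[of _ "\<pi> \<circ> \<rho>"]) (simp add: bij_comp matrix_mul_assoc)
qed

lemma permutes_columns_inv:
  assumes "permutes_columns P"
  shows "matrix_inv P ** P = mat 1" "permutes_columns (matrix_inv P)"
proof -
  obtain \<pi> where \<pi>: "bij \<pi>" and col: "\<And>M :: mat3. \<And>j. column j (M ** P) = column (\<pi> j) M"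
    using assms unfolding permutes_columns_def by blast
  have inv: "\<pi> (inv \<pi> j) = j" for j using \<pi> by (simp add: bij_is_surj surj_f_inv_f)
  \<comment> \<open>The permutation matrix of \<open>inv \<pi>\<close>. Being a right inverse of a
    square matrix, it shows \<open>P\<close> invertible, so \<open>matrix_inv P\<close> is a genuine
    inverse.\<close>
  define Q :: mat3 where "Q = (\<chi> i j. if i = inv \<pi> j then 1 else 0)"
  have "column j Q = axis (inv \<pi> j) 1" for j
    by (simp add: Q_def column_def axis_def vec_eq_iff)
  then have "column j (P ** Q) = column j (mat 1)" for j
    by (metis column_mult matrix_vector_mult_basis col inv matrix_mul_lid)
  then have "P ** Q = mat 1" by (rule columns_eqI)
  then have "invertible P" using invertible_right_inverse by blast
  then show *: "matrix_inv P ** P = mat 1" 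
    unfolding invertible_def matrix_inv_def by (metis (mono_tags, lifting) someI_ex)
  have "column j (M ** matrix_inv P) = column (inv \<pi> j) M" for M :: mat3 and j
    by (metis * col inv matrix_mul_assoc matrix_mul_rid)
  moreover have "bij (inv \<pi>)" using \<pi> by (simp add: bij_imp_bij_inv)
  ultimately show "permutes_columns (matrix_inv P)"
    unfolding permutes_columns_def by blast
qed

lemma column_mult_perm [simp]:
  "column j P = axis k 1 \<Longrightarrow> column j (M ** P) = column k (M :: mat3)"
  by (simp add: column_mult matrix_vector_mult_basis)

lemma column_mult_F [simp]:
  "column 1 (M ** F0) = column 2 M" "column 2 (M ** F0) = column 3 M"
  "column 3 (M ** F0) = column 1 M + column 3 M"
  "column 1 (M ** F1) = column 1 M" "column 2 (M ** F1) = column 2 M"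
  "column 3 (M ** F1) = column 1 M + column 3 M"
  by (simp_all add: F0_def F1_def mat3_of_rows_def column_def vec_eq_iff
      matrix_matrix_mult_def sum_3)

lemma column_mult_G [simp]:
  "column 1 (M ** G0) = column 2 M" "column 2 (M ** G0) = column 3 M"
  "column 3 (M ** G0) = midpoint (column 1 M) (column 3 M)"
  "column 1 (M ** G1) = column 1 M" "column 2 (M ** G1) = column 2 M"
  "column 3 (M ** G1) = midpoint (column 1 M) (column 3 M)"
  by (simp_all add: G0_def G1_def mat3_of_rows_def column_def vec_eq_iff
      matrix_matrix_mult_def sum_3 midpoint_def field_simps)

text \<open>By these identities the operation \<open>swap\<close> merely exchanges the digits 0 and
  1.\<close>

lemma p13_mult_p12:
  "p13 ** F1 ** p12 = F0" "p13 ** F0 ** p12 = F1" "p13 ** G1 ** p12 = G0" "p13 ** G0 ** p12 = G1"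
  by (simp_all add: perm_defs F0_def F1_def G0_def G1_def vec_eq_iff forall_3
      matrix_matrix_mult_def sum_3)

section \<open>Contraction of the midpoint subdivision\<close>

text \<open>Measured on the columns in space, before projection, where a G step only keeps columns
  and forms a midpoint.\<close>

definition width_le :: "mat3 \<Rightarrow> real \<Rightarrow> bool" where
  "width_le M d \<longleftrightarrow> (\<forall>j k. dist (column j M) (column k M) \<le> d)"

lemma width_le_permutes_columns:
  assumes "permutes_columns P"
  shows "width_le (M ** P) d \<longleftrightarrow> width_le M d"
proof -
  obtain \<pi> where \<pi>: "bij \<pi>" and col: "\<And>M :: mat3. \<And>j. column j (M ** P) = column (\<pi> j) M"
    using assms unfolding permutes_columns_def by blast
  then show ?thesis
    unfolding width_le_def col by (metis bij_is_surj surjD)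
qed

definition G_fold :: "triple \<Rightarrow> mat3 \<Rightarrow> bool list \<Rightarrow> mat3" where
  "G_fold t = foldl (\<lambda>M i. M ** G_trip t i)"

lemma G_fold_simps [simp]:
  "G_fold t M [] = M" "G_fold t M (i # w) = G_fold t (M ** G_trip t i) w"
  "G_fold t M (u @ w) = G_fold t (G_fold t M u) w"
  by (simp_all add: G_fold_def)

text \<open>A single step keeps an old edge, so the factor is asked of blocks of \<open>N\<close>
  digits. Uniformity in \<open>M\<close> lets blocks be chained.\<close>

definition contracts :: "triple \<Rightarrow> bool" where
  "contracts t \<longleftrightarrow> (\<exists>N. \<exists>c. 0 \<le> c \<and> c < 1 \<and>
     (\<forall>w M d. length w = N \<longrightarrow> width_le M d \<longrightarrow> width_le (G_fold t M w) (c * d)))"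

lemma contracts_swap:
  assumes "contracts (\<sigma>, \<tau>0, \<tau>1)"
  shows "contracts (\<sigma> ** p13, p12 ** \<tau>1, p12 ** \<tau>0)" (is "contracts ?t")
proof -
  have "\<sigma> ** p13 ** G1 ** (p12 ** \<tau>0) = \<sigma> ** (p13 ** G1 ** p12) ** \<tau>0"
    "\<sigma> ** p13 ** G0 ** (p12 ** \<tau>1) = \<sigma> ** (p13 ** G0 ** p12) ** \<tau>1"
    by (simp_all only: matrix_mul_assoc)
  then have "G_trip ?t i = G_trip (\<sigma>, \<tau>0, \<tau>1) (\<not> i)" for i
    by (simp add: p13_mult_p12)
  then have "G_fold ?t M w = G_fold (\<sigma>, \<tau>0, \<tau>1) M (map Not w)" for M w
    by (induction w arbitrary: M) simp_all
  with assms show ?thesis unfolding contracts_def by (metis length_map)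
qed

text \<open>In a product the inner \<open>\<rho>\<close> and \<open>matrix_inv \<rho>\<close>
  cancel; the outer ones only permute columns, which leaves the width unchanged.\<close>

lemma contracts_conj:
  assumes "contracts (\<sigma>, \<tau>0, \<tau>1)" "permutes_columns \<rho>"
  shows "contracts (\<rho> ** \<sigma>, \<tau>0 ** matrix_inv \<rho>, \<tau>1 ** matrix_inv \<rho>)" (is "contracts ?t")
proof -
  note inv = permutes_columns_inv[OF assms(2)]
  have G: "G_trip ?t i = \<rho> ** G_trip (\<sigma>, \<tau>0, \<tau>1) i ** matrix_inv \<rho>" for i
    by (simp add: matrix_mul_assoc)
  have cancel: "A ** matrix_inv \<rho> ** \<rho> = A" for A :: mat3
    by (metis inv(1) matrix_mul_assoc matrix_mul_rid)
  have "G_fold ?t M w ** \<rho> = G_fold (\<sigma>, \<tau>0, \<tau>1) (M ** \<rho>) w" for M w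
    by (induction w arbitrary: M) (simp_all add: G matrix_mul_assoc cancel del: G_trip.simps)
  with assms show ?thesis
    unfolding contracts_def by (metis width_le_permutes_columns)
qed

text \<open>The bounds are kept apart because a step treats the edges differently: the middle one
  belongs to the edge bisected by \<open>G0\<close> and \<open>G1\<close>.\<close>

definition edges_le :: "mat3 \<Rightarrow> real \<times> real \<times> real \<Rightarrow> bool" where
  "edges_le M = (\<lambda>(a, b, c). dist (column 1 M) (column 2 M) \<le> a \<and>
     dist (column 1 M) (column 3 M) \<le> b \<and> dist (column 2 M) (column 3 M) \<le> c)"

lemma width_le_iff_edges_le: "width_le M d \<longleftrightarrow> edges_le M (d, d, d)"
proof -
  \<comment> \<open>\<open>width_le\<close> also compares a column with itself, which asks for
    \<open>0 \<le> d\<close>.\<close>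
  have "d \<ge> 0" if "dist (column 1 M) (column 2 M) \<le> d" using that zero_le_dist order_trans by blast
  then show ?thesis
    unfolding width_le_def edges_le_def forall_3 by (auto simp: dist_commute)
qed

text \<open>In five steps at most five halvings occur, so any gain over \<open>d\<close> is at least \<open>d / 32\<close>.\<close>

lemma contractsI:
  assumes step: "\<And>M e i. edges_le M e \<Longrightarrow> edges_le (M ** G_trip t i) (f i e)"
    and f: "\<And>d i1 i2 i3 i4 i5. 0 \<le> d \<Longrightarrow>
      (case f i5 (f i4 (f i3 (f i2 (f i1 (d, d, d))))) of
         (a, b, c) \<Rightarrow> a \<le> 31/32 * d \<and> b \<le> 31/32 * d \<and> c \<le> 31/32 * d)"
  shows "contracts t"
proof -
  have "width_le (G_fold t M w) (31/32 * d)" if "length w = 5" "width_le M d" for w M d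
  proof -
    have "length w = Suc (Suc (Suc (Suc (Suc 0))))" using that(1) by simp
    then obtain i1 i2 i3 i4 i5 where w: "w = [i1, i2, i3, i4, i5]"
      by (auto simp only: length_Suc_conv length_0_conv)
    have "0 \<le> d" using that(2) unfolding width_le_def by (metis dist_self)
    have "edges_le M (d, d, d)" using that(2) by (simp add: width_le_iff_edges_le)
    then have "edges_le (G_fold t M w) (f i5 (f i4 (f i3 (f i2 (f i1 (d, d, d))))))"
      unfolding w by (simp add: step)
    with f[OF \<open>0 \<le> d\<close>, of i5 i4 i3 i2 i1] show ?thesis
      unfolding width_le_iff_edges_le by (fastforce simp: edges_le_def split: prod.splits)
  qed
  then show ?thesis
    unfolding contracts_def by (intro exI[of _ 5] exI[of _ "31/32"]) auto
qed

lemma dist_midpoint_le: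
  fixes x y z :: "'a::real_normed_vector"
  assumes "dist x y \<le> a" "dist z y \<le> c"
  shows "dist y (midpoint x z) \<le> (a + c) / 2"
proof -
  have "y - midpoint x z = (1/2) *\<^sub>R ((y - x) + (y - z))"
    by (simp add: midpoint_def algebra_simps) (metis scaleR_half_double scaleR_right_distrib)
  then have "dist y (midpoint x z) = norm ((y - x) + (y - z)) / 2"
    by (simp add: dist_norm)
  also have "\<dots> \<le> (norm (y - x) + norm (y - z)) / 2"
    using norm_triangle_ineq by (simp add: divide_right_mono)
  finally show ?thesis using assms by (simp add: dist_norm norm_minus_commute)
qed

text \<open>The third column becomes the midpoint: \<open>b / 2\<close> is its distance to an end of
  the bisected edge, \<open>(a + c) / 2\<close> bounds its distance to the opposite vertex.\<close>

lemma edges_le_G: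
  assumes "edges_le M (a, b, c)"
  shows "edges_le (M ** G0) (c, (a + c) / 2, b / 2)" "edges_le (M ** G1) (a, b / 2, (a + c) / 2)"
  using assms dist_midpoint_le[of "column 1 M" "column 2 M" a "column 3 M" c]
  by (auto simp: edges_le_def dist_midpoint dist_commute)

lemma edges_le_perm:
  assumes "edges_le M (a, b, c)"
  shows "edges_le (M ** p_e) (a, b, c)" "edges_le (M ** p23) (b, a, c)"
    "edges_le (M ** p132) (c, a, b)"
  using assms by (auto simp: edges_le_def dist_commute)

lemma contracts_representatives:
  "contracts (p_e, p_e, p23)" "contracts (p_e, p_e, p132)" "contracts (p_e, p23, p132)"
proof -
  \<comment> \<open>Each \<open>?f\<close> follows the bounds of \<open>edges_le_G\<close> by the
    relabelling in \<open>edges_le_perm\<close>: \<open>p23\<close> exchanges the first two bounds,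
    \<open>p132\<close> rotates all three.\<close>
  let ?f = "\<lambda>i (a, b, c). if i then (b / 2, a, (a + c) / 2) else (c, (a + c) / 2, b / 2 :: real)"
  show "contracts (p_e, p_e, p23)"
  proof (rule contractsI[where f = ?f])
    fix M :: mat3 and e :: "real \<times> real \<times> real" and i
    assume "edges_le M e"
    then show "edges_le (M ** G_trip (p_e, p_e, p23) i) (?f i e)"
      by (cases e) (auto simp: matrix_mul_assoc intro!: edges_le_G edges_le_perm)
  next
    fix d :: real and i1 i2 i3 i4 i5 assume "0 \<le> d"
    then show "case ?f i5 (?f i4 (?f i3 (?f i2 (?f i1 (d, d, d))))) of
      (a, b, c) \<Rightarrow> a \<le> 31/32 * d \<and> b \<le> 31/32 * d \<and> c \<le> 31/32 * d"
      \<comment> \<open>For each of the 32 words the three bounds are fixed multiples of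
        \<open>d\<close>.\<close>
      by (cases i1; cases i2; cases i3; cases i4; cases i5) (simp_all add: field_simps)
  qed
  let ?f = "\<lambda>i (a, b, c). if i then ((a + c) / 2, a, b / 2) else (c, (a + c) / 2, b / 2 :: real)"
  show "contracts (p_e, p_e, p132)"
  proof (rule contractsI[where f = ?f])
    fix M :: mat3 and e :: "real \<times> real \<times> real" and i
    assume "edges_le M e"
    then show "edges_le (M ** G_trip (p_e, p_e, p132) i) (?f i e)"
      by (cases e) (auto simp: matrix_mul_assoc intro!: edges_le_G edges_le_perm)
  next
    fix d :: real and i1 i2 i3 i4 i5 assume "0 \<le> d"
    then show "case ?f i5 (?f i4 (?f i3 (?f i2 (?f i1 (d, d, d))))) of
      (a, b, c) \<Rightarrow> a \<le> 31/32 * d \<and> b \<le> 31/32 * d \<and> c \<le> 31/32 * d"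
      by (cases i1; cases i2; cases i3; cases i4; cases i5) (simp_all add: field_simps)
  qed
  let ?f = "\<lambda>i (a, b, c). if i then ((a + c) / 2, a, b / 2) else ((a + c) / 2, c, b / 2 :: real)"
  show "contracts (p_e, p23, p132)"
  proof (rule contractsI[where f = ?f])
    fix M :: mat3 and e :: "real \<times> real \<times> real" and i
    assume "edges_le M e"
    then show "edges_le (M ** G_trip (p_e, p23, p132) i) (?f i e)"
      by (cases e) (auto simp: matrix_mul_assoc intro!: edges_le_G edges_le_perm)
  next
    fix d :: real and i1 i2 i3 i4 i5 assume "0 \<le> d"
    then show "case ?f i5 (?f i4 (?f i3 (?f i2 (?f i1 (d, d, d))))) of
      (a, b, c) \<Rightarrow> a \<le> 31/32 * d \<and> b \<le> 31/32 * d \<and> c \<le> 31/32 * d"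
      by (cases i1; cases i2; cases i3; cases i4; cases i5) (simp_all add: field_simps)
  qed
qed

section \<open>Invariance over a class\<close>

fun permutes_trip :: "triple \<Rightarrow> bool" where
  "permutes_trip (\<sigma>, \<tau>0, \<tau>1) \<longleftrightarrow>
     permutes_columns \<sigma> \<and> permutes_columns \<tau>0 \<and> permutes_columns \<tau>1"

lemma trip_class_invariant:
  assumes "t' \<in> trip_class t" "permutes_trip t" "contracts t"
  shows "permutes_trip t' \<and> contracts t'"
  using assms(1)
proof (induction rule: trip_class.induct)
  case base
  then show ?case using assms by blast
next
  case (swap \<sigma> \<tau>0 \<tau>1)
  have "permutes_columns p12" "permutes_columns p13"
    by (auto intro: S3_permutes_columns simp: S3_def)
  with swap show ?case by (auto intro: permutes_columns_mult contracts_swap)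
next
  case (conj \<sigma> \<tau>0 \<tau>1 \<rho>)
  then have "permutes_columns \<rho>" by (simp add: S3_permutes_columns)
  with conj show ?case
    by (auto intro: permutes_columns_mult permutes_columns_inv contracts_conj)
qed

section \<open>Limits of the midpoint subdivision\<close>

text \<open>Positive denominators in \<open>proj\<close> make a sum of columns project between the
  images of the summands.\<close>

definition pos :: "mat3 \<Rightarrow> bool" where
  "pos M \<longleftrightarrow> (\<forall>j. 0 < column j M $ 1)"

lemma range_3: "range f = {f 1, f 2, f (3 :: 3)}"
  by (auto simp: UNIV_3)

lemma pos_permutes_columns: "permutes_columns P \<Longrightarrow> pos M \<Longrightarrow> pos (M ** P)"
  unfolding permutes_columns_def pos_def by auto

lemma pos_mult_F: "pos M \<Longrightarrow> pos (M ** F0)" "pos M \<Longrightarrow> pos (M ** F1)"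
  by (simp_all add: pos_def forall_3)

lemma vertex_mult_perm:
  assumes "permutes_columns P"
  obtains \<pi> where "bij \<pi>" "\<And>M. vertex (M ** P) = vertex M \<circ> \<pi>"
proof -
  obtain \<pi> where "bij \<pi>" "\<And>M :: mat3. \<And>j. column j (M ** P) = column (\<pi> j) M"
    using assms unfolding permutes_columns_def by blast
  then show ?thesis by (intro that[of \<pi>]) (auto simp: vertex_def)
qed

lemma range_vertex_perm: "permutes_columns P \<Longrightarrow> range (vertex (M ** P)) = range (vertex M)"
  by (metis vertex_mult_perm bij_is_surj image_comp)

lemma proj_scaleR: "k \<noteq> 0 \<Longrightarrow> proj (k *\<^sub>R v) = proj v"
  by (simp add: proj_def)

lemma proj_midpoint: "proj (midpoint u v) = proj (u + v)"
  unfolding midpoint_def by (rule proj_scaleR) simp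

text \<open>This is the mediant: dividing by the summed first entries weights each image by its own
  first entry.\<close>

lemma proj_add:
  assumes "0 < u $ 1" "0 < v $ 1"
  shows "proj (u + v) = (1 - v $ 1 / (u $ 1 + v $ 1)) *\<^sub>R proj u + (v $ 1 / (u $ 1 + v $ 1)) *\<^sub>R proj v"
proof -
  have "u $ 1 + v $ 1 \<noteq> 0" using assms by linarith
  moreover have "1 - v $ 1 / (u $ 1 + v $ 1) = u $ 1 / (u $ 1 + v $ 1)"
    using calculation by (simp add: field_simps)
  ultimately show ?thesis
    using assms by (simp add: proj_def add_divide_distrib)
qed

text \<open>\<open>proj\<close> ignores the factor 1/2 of the new column. From the same matrix both
  steps give the same triangle; the subdivisions differ only through the column scales, which govern
  later cuts.\<close>

lemma vertex_mult_G: "vertex (M ** G0) = vertex (M ** F0)" "vertex (M ** G1) = vertex (M ** F1)"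
  by (simp_all add: fun_eq_iff forall_3 vertex_def proj_midpoint)

lemma F_prod_simps: "F_prod t [] = V" "F_prod t (w @ [i]) = F_prod t w ** F_trip t i"
  by (simp_all add: F_prod_def)

lemma G_prod_simps: "G_prod t [] = V" "G_prod t (w @ [i]) = G_prod t w ** G_trip t i"
  by (simp_all add: G_prod_def)

lemma column_V:
  "column 1 V = vector [1, 0, 0]" "column 2 V = vector [1, 1, 0]" "column 3 V = vector [1, 1, 1]"
  by (simp_all add: V_def mat3_of_rows_def column_def vec_eq_iff forall_3)

lemma vertex_V: "vertex V 1 = (0, 0)" "vertex V 2 = (1, 0)" "vertex V 3 = (1, 1)"
  by (simp_all add: vertex_def column_V proj_def)

lemma prefix_word_simps:
  "prefix_word i 0 = []" "prefix_word i (Suc n) = prefix_word i n @ [i n]"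
  "length (prefix_word i n) = n"
  by (simp_all add: prefix_word_def)

locale permuted_subdivision =
  fixes \<sigma> \<tau>0 \<tau>1 :: mat3
  assumes perms: "permutes_columns \<sigma>" "permutes_columns \<tau>0" "permutes_columns \<tau>1"
begin

abbreviation t :: triple where "t \<equiv> (\<sigma>, \<tau>0, \<tau>1)"

text \<open>The vertices as \<open>F0\<close> and \<open>F1\<close> see them: corners 1 and 3 end
  the edge to be cut, corner 2 is opposite.\<close>

definition corner :: "mat3 \<Rightarrow> 3 \<Rightarrow> real \<times> real" where
  "corner M = vertex (M ** \<sigma>)"

definition cut :: "mat3 \<Rightarrow> real \<times> real" where
  "cut M = proj (column 1 (M ** \<sigma>) + column 3 (M ** \<sigma>))"

lemma range_vertex: "range (vertex M) = {corner M 1, corner M 2, corner M 3}"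
  unfolding corner_def range_3[symmetric] by (simp add: range_vertex_perm perms)

lemma range_vertex_F_trip:
  "range (vertex (M ** F_trip t False)) = {corner M 2, corner M 3, cut M}"
  "range (vertex (M ** F_trip t True)) = {corner M 1, corner M 2, cut M}"
proof -
  have "range (vertex (M ** F_trip t False)) = range (vertex (M ** \<sigma> ** F0))"
    "range (vertex (M ** F_trip t True)) = range (vertex (M ** \<sigma> ** F1))"
    by (simp_all add: matrix_mul_assoc range_vertex_perm perms)
  then show
    "range (vertex (M ** F_trip t False)) = {corner M 2, corner M 3, cut M}"
    "range (vertex (M ** F_trip t True)) = {corner M 1, corner M 2, cut M}"
    unfolding range_3 corner_def cut_def vertex_def by simp_all
qed

lemma proj_triangle_eq:
  "proj_triangle M = convex hull {corner M 1, corner M 2, corner M 3}"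
  "proj_triangle (M ** F_trip t False) = convex hull {corner M 2, corner M 3, cut M}"
  "proj_triangle (M ** F_trip t True) = convex hull {corner M 1, corner M 2, cut M}"
  unfolding proj_triangle_def range_vertex_F_trip by (simp_all add: range_vertex)

lemma vertex_G_trip: "vertex (M ** G_trip t i) = vertex (M ** F_trip t i)"
proof -
  obtain \<pi>0 where "\<And>M. vertex (M ** \<tau>0) = vertex M \<circ> \<pi>0"
    using vertex_mult_perm[OF perms(2)] by metis
  moreover obtain \<pi>1 where "\<And>M. vertex (M ** \<tau>1) = vertex M \<circ> \<pi>1"
    using vertex_mult_perm[OF perms(3)] by metis
  ultimately show ?thesis by (simp add: matrix_mul_assoc vertex_mult_G)
qed

text \<open>Positive first entries put the mediant weights strictly between 0 and 1.\<close>

lemma split_triangle: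
  assumes "pos M"
  obtains s where "split_triangle (corner M 1) (corner M 3) (cut M) s"
proof
  let ?u = "column 1 (M ** \<sigma>)" and ?v = "column 3 (M ** \<sigma>)"
  have "0 < ?u $ 1" "0 < ?v $ 1"
    using pos_permutes_columns[OF perms(1) assms] by (auto simp: pos_def)
  then show "split_triangle (corner M 1) (corner M 3) (cut M) (?v $ 1 / (?u $ 1 + ?v $ 1))"
    unfolding cut_def corner_def vertex_def
    by unfold_locales (simp_all add: proj_add)
qed

lemma pos_F_trip: "pos M \<Longrightarrow> pos (M ** F_trip t i)"
  by (simp add: matrix_mul_assoc pos_permutes_columns perms pos_mult_F)

lemma proj_triangle_F_trip_subset:
  assumes "pos M"
  shows "proj_triangle (M ** F_trip t i) \<subseteq> proj_triangle M"
proof -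
  obtain s where "split_triangle (corner M 1) (corner M 3) (cut M) s"
    using split_triangle[OF assms] by blast
  note sub = split_triangle.halves_subset[OF this, of "corner M 2"]
  show ?thesis
    unfolding proj_triangle_eq(1)[of M]
    using sub by (cases i) (simp_all only: proj_triangle_eq(2,3))
qed

text \<open>Midpoints and column permutations preserve the first entry 1. Hence on these products
  \<open>proj\<close> just drops a coordinate.\<close>

lemma first_row_G_prod: "column j (G_prod t w) $ 1 = 1"
proof (induction w arbitrary: j rule: rev_induct)
  case Nil
  show ?case using exhaust_3[of j] by (auto simp: G_prod_simps column_V)
next
  case (snoc i w)
  define M where "M = G_prod t w ** \<sigma>"
  obtain \<pi> where "\<And>N :: mat3. \<And>j. column j (N ** \<tau>0) = column (\<pi> j) N"
    using perms(2) unfolding permutes_columns_def by metis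
  moreover obtain \<pi>' where "\<And>N :: mat3. \<And>j. column j (N ** \<tau>1) = column (\<pi>' j) N"
    using perms(3) unfolding permutes_columns_def by metis
  moreover obtain \<pi>'' where "\<And>N :: mat3. \<And>j. column j (N ** \<sigma>) = column (\<pi>'' j) N"
    using perms(1) unfolding permutes_columns_def by metis
  then have "\<forall>j. column j M $ 1 = 1" using snoc.IH by (simp add: M_def)
  then have "\<forall>j. column j (M ** G0) $ 1 = 1" "\<forall>j. column j (M ** G1) $ 1 = 1"
    by (simp_all add: forall_3 midpoint_def)
  ultimately show ?case
    by (simp add: G_prod_simps matrix_mul_assoc flip: M_def)
qed

lemma pos_G_prod: "pos (G_prod t w)"
  by (simp add: pos_def first_row_G_prod)

text \<open>The containment for \<open>F_trip\<close> is applied to the matrix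
  \<open>G_prod t w\<close>, whose children have the same vertices under either step.\<close>

lemma Gam_snoc_subset: "Gam t (w @ [i]) \<subseteq> Gam t w"
  using proj_triangle_F_trip_subset[OF pos_G_prod, of w i]
  unfolding Gam_def G_prod_simps proj_triangle_def vertex_G_trip .

lemma Gam_dist_le:
  assumes "width_le (G_prod t w) d" "p \<in> Gam t w" "q \<in> Gam t w"
  shows "dist p q \<le> d"
proof -
  have "dist (vertex (G_prod t w) j) (vertex (G_prod t w) k) \<le> d" for j k
  proof -
    let ?u = "column j (G_prod t w)" and ?v = "column k (G_prod t w)"
    have "dist (proj ?u) (proj ?v) = sqrt ((?u $ 2 - ?v $ 2)\<^sup>2 + (?u $ 3 - ?v $ 3)\<^sup>2)"
      by (simp add: proj_def first_row_G_prod dist_Pair_Pair dist_real_def)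
    also have "\<dots> \<le> dist ?u ?v"
      by (simp add: dist_vec_def L2_set_def sum_3 dist_real_def)
    finally show ?thesis
      using assms(1) unfolding width_le_def vertex_def by (meson order_trans)
  qed
  \<comment> \<open>A distance within the hull of finitely many points is at most one between two of
    these points.\<close>
  moreover obtain j k where
    "dist p q \<le> dist (vertex (G_prod t w) j) (vertex (G_prod t w) k)"
    using simplex_extremal_le_exists[of "range (vertex (G_prod t w))" p q] assms(2,3)
    unfolding Gam_def proj_triangle_def dist_norm by auto
  ultimately show ?thesis by (meson order_trans)
qed

text \<open>Each block of \<open>N\<close> digits multiplies the width bound by \<open>c\<close>, so
  the level needed does not depend on the word.\<close>

lemma G_prod_width_le:
  assumes "contracts t" "0 < e"
  obtains n where "\<And>w. length w = n \<Longrightarrow> width_le (G_prod t w) e"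
proof -
  obtain N c where c: "0 \<le> c" "c < 1"
    and N: "\<And>w M d. length w = N \<Longrightarrow> width_le M d \<Longrightarrow> width_le (G_fold t M w) (c * d)"
    using assms(1) unfolding contracts_def by blast
  obtain d where d: "width_le V d" "0 < d"
  proof
    let ?S = "range (\<lambda>(j, k). dist (column j V) (column k V))"
    show "width_le V (Max ?S + 1)"
      unfolding width_le_def by (force intro: add_increasing2 Max_ge)
    have "0 \<le> Max ?S" by (rule Max_ge_iff[THEN iffD2]) auto
    then show "0 < Max ?S + 1" by simp
  qed
  have k: "width_le (G_fold t V w) (c ^ k * d)" if "length w = k * N" for k w
    using that
  proof (induction k arbitrary: w)
    case 0
    then show ?case using d by simp
  next
    case (Suc k)
    let ?u = "take (k * N) w" and ?v = "drop (k * N) w"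
    have "width_le (G_fold t V ?u) (c ^ k * d)" using Suc by simp
    then have "width_le (G_fold t (G_fold t V ?u) ?v) (c * (c ^ k * d))"
      using Suc.prems by (intro N) auto
    then show ?case by (metis G_fold_simps(3) append_take_drop_id mult.assoc power_Suc)
  qed
  have "(\<lambda>k. c ^ k * d) \<longlonglongrightarrow> 0"
    using c by (intro tendsto_mult_left_zero LIMSEQ_power_zero) auto
  then obtain k where "c ^ k * d < e"
    using assms(2) by (metis (no_types, lifting) order_tendstoD(2) eventually_sequentially order_refl)
  with k have "width_le (G_prod t w) e" if "length w = k * N" for w
    using that unfolding width_le_def G_prod_def G_fold_def by (meson less_imp_le order_trans)
  then show ?thesis using that by blast
qed

text \<open>Cantor's intersection theorem for nested nonempty closed sets of vanishing
  diameter.\<close>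

lemma Gam_limit_singleton:
  assumes "contracts t"
  shows "\<exists>q. Gam_limit t i = {q}"
proof -
  \<comment> \<open>The shift matches \<open>Gam_limit\<close>, which starts at level 1.\<close>
  let ?S = "\<lambda>n. Gam t (prefix_word i (Suc n))"
  have mono: "Gam t (prefix_word i n) \<subseteq> Gam t (prefix_word i m)" if "m \<le> n" for m n
    using that by (rule lift_Suc_antimono_le[rotated]) (simp add: prefix_word_simps Gam_snoc_subset)
  have "\<exists>q. \<Inter> (range ?S) = {q}"
  proof (rule decreasing_closed_nest_sing)
    show "closed (?S n)" for n
      unfolding Gam_def proj_triangle_def
      by (intro compact_imp_closed finite_imp_compact_convex_hull) simp
    show "?S n \<noteq> {}" for n
      unfolding Gam_def proj_triangle_def by simp
    show "?S n \<subseteq> ?S m" if "m \<le> n" for m n using that mono by simp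
    fix e :: real assume "0 < e"
    \<comment> \<open>Half of \<open>e\<close>, since \<open>width_le\<close> is a weak bound and a
      strict one is wanted.\<close>
    then obtain n where n: "\<And>w. length w = n \<Longrightarrow> width_le (G_prod t w) (e / 2)"
      using G_prod_width_le[OF assms, of "e / 2"] by (metis half_gt_zero)
    have "dist x y < e" if "x \<in> ?S n" "y \<in> ?S n" for x y
    proof -
      have "x \<in> Gam t (prefix_word i n)" "y \<in> Gam t (prefix_word i n)"
        using that mono[of n "Suc n"] by auto
      then have "dist x y \<le> e / 2"
        using n Gam_dist_le by (metis prefix_word_simps(3))
      with \<open>0 < e\<close> show ?thesis by simp
    qed
    then show "\<exists>n. \<forall>x\<in>?S n. \<forall>y\<in>?S n. dist x y < e" by blast
  qed
  moreover have "Gam_limit t i = \<Inter> (range ?S)"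
    unfolding Gam_limit_def by (auto simp: Suc_le_eq gr0_conv_Suc)
  ultimately show ?thesis by simp
qed

section \<open>The relation is a function\<close>

lemma pos_F_prod: "pos (F_prod t w)"
proof (induction w rule: rev_induct)
  case Nil
  show ?case by (simp add: pos_def forall_3 F_prod_simps column_V)
qed (simp add: F_prod_simps pos_F_trip del: F_trip.simps)

lemma Tri_snoc_subset: "Tri t (w @ [i]) \<subseteq> Tri t w"
  unfolding Tri_def F_prod_simps by (rule proj_triangle_F_trip_subset[OF pos_F_prod])

lemma not_collinear_F_prod: "\<not> collinear (range (vertex (F_prod t w)))"
proof (induction w rule: rev_induct)
  case Nil
  show ?case
    unfolding range_3 F_prod_simps vertex_V collinear_3_expand by simp
next
  case (snoc i w)
  obtain s where "split_triangle (corner (F_prod t w) 1) (corner (F_prod t w) 3) (cut (F_prod t w)) s"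
    using split_triangle[OF pos_F_prod] by blast
  from split_triangle.halves_not_collinear[OF this, of "corner (F_prod t w) 2"] snoc show ?case
    unfolding F_prod_simps range_vertex[of "F_prod t w"]
    by (cases i) (simp_all only: range_vertex_F_trip not_False_eq_True simp_thms)
qed

text \<open>Frees later arguments from matrices. \<open>b\<close> and \<open>m\<close> are
  identified because the affine maps are compared at these points.\<close>

lemma Tri_children:
  obtains a b c m s where "split_triangle a c m s" "\<not> collinear {a, b, c}"
    "Tri t w = convex hull {a, b, c}" "Tri t (w @ [False]) = convex hull {b, c, m}"
    "Tri t (w @ [True]) = convex hull {a, b, m}" "b = corner (F_prod t w) 2" "m = cut (F_prod t w)"
proof -
  obtain s where "split_triangle (corner (F_prod t w) 1) (corner (F_prod t w) 3) (cut (F_prod t w)) s"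
    using split_triangle[OF pos_F_prod] by blast
  then show ?thesis
    using not_collinear_F_prod[of w] unfolding range_vertex
    by (rule that) (simp_all only: Tri_def F_prod_simps proj_triangle_eq(2,3)
        proj_triangle_eq(1)[of "F_prod t w"])
qed

lemma Tri_closed: "closed (Tri t w)"
  unfolding Tri_def proj_triangle_def
  by (intro compact_imp_closed finite_imp_compact_convex_hull) simp

lemma Tri_subset_closure_interior: "Tri t w \<subseteq> closure (interior (Tri t w))"
proof -
  have "interior (Tri t w) \<noteq> {}"
    using Tri_children[of w] triangle_interior_nonempty by metis
  then show ?thesis
    using convex_closure_interior[of "Tri t w"] closure_subset
    by (metis Tri_def convex_convex_hull proj_triangle_def)
qed

lemma frontier_Tri: "p \<in> frontier (Tri t w) \<longleftrightarrow> p \<in> Tri t w \<and> p \<notin> interior (Tri t w)"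
  by (simp add: frontier_def Tri_closed)

text \<open>Induction on the last digit: siblings meet only in a segment, and children of different
  parents inherit disjointness.\<close>

lemma Tri_interiors_disjoint:
  "length u = length w \<Longrightarrow> u \<noteq> w \<Longrightarrow> interior (Tri t u) \<inter> interior (Tri t w) = {}"
proof (induction u arbitrary: w rule: rev_induct)
  case Nil
  then show ?case by simp
next
  case (snoc i u)
  then obtain j w' where w: "w = w' @ [j]" by (cases w rule: rev_cases) auto
  show ?case
  proof (cases "u = w'")
    case True
    obtain a b c m s where "split_triangle a c m s" "\<not> collinear {a, b, c}"
      "Tri t (u @ [False]) = convex hull {b, c, m}" "Tri t (u @ [True]) = convex hull {a, b, m}"
      using Tri_children by metis
    then have "interior (Tri t (u @ [False])) \<inter> interior (Tri t (u @ [True])) = {}"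
      by (metis split_triangle.halves_interior_disjoint)
    moreover have "j = (\<not> i)" using snoc.prems True w by auto
    ultimately show ?thesis unfolding w True by (cases i) auto
  next
    case False
    then have "interior (Tri t u) \<inter> interior (Tri t w') = {}"
      using snoc w by simp
    then show ?thesis
      using interior_mono[OF Tri_snoc_subset] w by blast
  qed
qed

text \<open>An open set meeting a closure meets the set itself, so for distinct words the two
  interiors would intersect.\<close>

lemma Tri_Int_interior:
  assumes "length u = length w" "p \<in> interior (Tri t u)" "p \<in> Tri t w"
  shows "u = w"
proof (rule ccontr)
  assume "u \<noteq> w"
  have "p \<in> closure (interior (Tri t w))" using assms(3) Tri_subset_closure_interior by blast
  then have "interior (Tri t u) \<inter> interior (Tri t w) \<noteq> {}"
    using open_Int_closure_eq_empty[OF open_interior] assms(2) by blast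
  with Tri_interiors_disjoint[OF assms(1) \<open>u \<noteq> w\<close>] show False by blast
qed

lemma open_triangle_interior: "open_triangle \<subseteq> interior (Tri t [])"
proof (rule interior_maximal)
  show "open_triangle \<subseteq> Tri t []"
  proof
    fix p assume "p \<in> open_triangle"
    then obtain x y where p: "p = (x, y)" "x < 1" "y < x" "0 < y"
      unfolding open_triangle_def by auto
    \<comment> \<open>Barycentric coordinates with respect to the vertices of the initial
      triangle.\<close>
    then have "p = (1 - x) *\<^sub>R (0, 0) + (x - y) *\<^sub>R (1, 0) + y *\<^sub>R (1, 1)" by simp
    with p show "p \<in> Tri t []"
      unfolding Tri_def proj_triangle_def F_prod_simps range_3 vertex_V convex_hull_3
      by (intro CollectI exI[of _ "1 - x"] exI[of _ "x - y"] exI[of _ y]) auto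
  qed
  have eq: "open_triangle = {p. fst p < 1} \<inter> {p. snd p < fst p} \<inter> {p. 0 < snd p}"
    unfolding open_triangle_def by auto
  show "open open_triangle"
    unfolding eq by (intro open_Int open_Collect_less continuous_intros)
qed

section \<open>Affine maps between corresponding triangles\<close>

lemma affine_map_F_G_exists:
  obtains f where "affine_map f" "\<And>j. f (vertex (F_prod t w) j) = vertex (G_prod t w) j"
proof -
  obtain f where "affine_map f" "\<forall>j. f (vertex (F_prod t w) j) = vertex (G_prod t w) j"
    using affine_map_exists not_collinear_F_prod[of w] unfolding range_3 forall_3 by metis
  then show ?thesis using that by blast
qed

lemma affine_map_F_G_unique:
  assumes "affine_map f" "\<And>j. f (vertex (F_prod t w) j) = vertex (G_prod t w) j"
    and "affine_map g" "\<And>j. g (vertex (F_prod t w) j) = vertex (G_prod t w) j"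
    and "p \<in> Tri t w"
  shows "f p = g p"
proof -
  obtain u v w' where "u + v + w' = 1"
    "p = u *\<^sub>R vertex (F_prod t w) 1 + v *\<^sub>R vertex (F_prod t w) 2 + w' *\<^sub>R vertex (F_prod t w) 3"
    using assms(5) unfolding Tri_def proj_triangle_def range_3 convex_hull_3 by blast
  then show ?thesis using assms by (simp add: affine_map_combination)
qed

text \<open>Both points are vertices of either child, so the images of the ends of the common edge
  do not depend on the digit \<open>i\<close>.\<close>

lemma affine_map_on_cut:
  assumes "\<And>j. f (vertex (M ** F_trip t i) j) = vertex (N ** G_trip t i) j"
  shows "f (corner M 2) = corner N 2" "f (cut M) = cut N"
proof -
  define P where "P = (if i then \<tau>1 else \<tau>0)"
  define S where "S = (if i then F1 else F0)"
  have F: "A ** F_trip t i = A ** \<sigma> ** S ** P" for A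
    by (simp add: S_def P_def matrix_mul_assoc)
  have "permutes_columns P" using perms by (simp add: P_def)
  then obtain \<pi> where \<pi>: "bij \<pi>" "\<And>A. vertex (A ** P) = vertex A \<circ> \<pi>"
    using vertex_mult_perm by blast
  \<comment> \<open>\<open>P\<close> permutes the vertices on both sides alike and can be stripped
    off.\<close>
  have "f (vertex (M ** \<sigma> ** S) (\<pi> j)) = vertex (N ** \<sigma> ** S) (\<pi> j)" for j
    using assms[of j] by (simp only: vertex_G_trip F \<pi>(2) comp_apply)
  then have "\<forall>j. f (vertex (M ** \<sigma> ** S) j) = vertex (N ** \<sigma> ** S) j"
    using \<pi>(1) by (metis bij_is_surj surjD)
  then show "f (corner M 2) = corner N 2" "f (cut M) = cut N"
    unfolding forall_3 S_def by (cases i; simp add: corner_def cut_def vertex_def)+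
qed

lemma affine_maps_agree_on_frontier:
  assumes f: "affine_map f" "\<And>j. f (vertex (F_prod t w) j) = vertex (G_prod t w) j"
    and g: "affine_map g" "\<And>j. g (vertex (F_prod t w') j) = vertex (G_prod t w') j"
    and p: "p \<in> frontier (Tri t w)" "p \<in> frontier (Tri t w')"
    and first: "\<And>v. length v < length w \<Longrightarrow> p \<notin> frontier (Tri t v)"
    and len: "length w = length w'"
  shows "f p = g p"
proof (cases "w = w'")
  case True
  then show ?thesis
    using affine_map_F_G_unique[of f w g p] assms by (simp add: frontier_Tri)
next
  case False
  then obtain u i u' i' where w: "w = u @ [i]" "w' = u' @ [i']"
    using len by (metis length_0_conv rev_exhaust)
  have in_Tri: "p \<in> Tri t w" "p \<in> Tri t w'" using p by (simp_all add: frontier_Tri)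
  then have "p \<in> Tri t u" "p \<in> Tri t u'" using Tri_snoc_subset w by blast+
  \<comment> \<open>No earlier boundary contains \<open>p\<close>, so \<open>p\<close> is interior
    to the parent of \<open>w\<close>; the other parent contains \<open>p\<close> and must coincide
    with it.\<close>
  moreover from this have "p \<in> interior (Tri t u)"
    using first[of u] by (simp add: frontier_Tri w)
  ultimately have "u = u'" using Tri_Int_interior len w by auto
  obtain a b c m s where split: "split_triangle a c m s" "\<not> collinear {a, b, c}"
    and T: "Tri t (u @ [False]) = convex hull {b, c, m}" "Tri t (u @ [True]) = convex hull {a, b, m}"
    and bm: "b = corner (F_prod t u) 2" "m = cut (F_prod t u)"
    using Tri_children by metis
  have "i' = (\<not> i)" using False w \<open>u = u'\<close> by auto
  then have "p \<in> convex hull {b, c, m} \<inter> convex hull {a, b, m}"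
    using in_Tri T w \<open>u = u'\<close> by (cases i) auto
  then have "p \<in> closed_segment b m"
    using split_triangle.halves_Int[OF split] by blast
  then obtain x where p_eq: "p = (1 - x) *\<^sub>R b + x *\<^sub>R m" by (auto simp: in_segment)
  have "h p = (1 - x) *\<^sub>R corner (G_prod t u) 2 + x *\<^sub>R cut (G_prod t u)"
    if "affine_map h" "\<And>j. h (vertex (F_prod t (u @ [k])) j) = vertex (G_prod t (u @ [k])) j" for h k
  proof -
    have "h b = corner (G_prod t u) 2" "h m = cut (G_prod t u)"
      using affine_map_on_cut[of h "F_prod t u" k "G_prod t u"] that(2)
      unfolding bm F_prod_simps G_prod_simps by blast+
    \<comment> \<open>The third weight is 0: on the segment only the values at \<open>b\<close> and
      \<open>m\<close> matter.\<close>
    with affine_map_combination[OF that(1), of "1 - x" x 0 b m b] show ?thesis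
      unfolding p_eq by simp
  qed
  from this[of f i] this[of g i'] show ?thesis using f g w \<open>u = u'\<close> by simp
qed

lemma interior_sequence_exists:
  assumes "p \<in> Tri t []" "\<And>w. p \<notin> frontier (Tri t w)"
  obtains i where "\<And>n. p \<in> interior (Tri t (prefix_word i n))"
proof -
  \<comment> \<open>Greedy address: digit 1 whenever that child contains \<open>p\<close>. The
    children cover their parent, so digit 0 works otherwise.\<close>
  define word where "word = rec_nat [] (\<lambda>_ w. w @ [p \<in> Tri t (w @ [True])])"
  define i where "i n = (p \<in> Tri t (word n @ [True]))" for n
  have word: "word 0 = []" "word (Suc n) = word n @ [i n]" for n
    by (simp_all add: word_def i_def)
  have "prefix_word i n = word n" for n
    by (induction n) (simp_all add: prefix_word_simps word)
  moreover have "p \<in> Tri t (word n)" for n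
  proof (induction n)
    case 0
    then show ?case using assms by (simp add: word)
  next
    case (Suc n)
    have "Tri t (word n) \<subseteq> Tri t (word n @ [False]) \<union> Tri t (word n @ [True])"
      using Tri_children[of "word n"] split_triangle.halves_cover by metis
    with Suc show ?case by (cases "i n") (auto simp: word i_def)
  qed
  ultimately show ?thesis using assms(2) that by (metis frontier_Tri)
qed

lemma Phi_functional:
  assumes "contracts t"
  shows "Phi_is_function t"
  unfolding Phi_is_function_def
proof
  fix p assume p: "p \<in> open_triangle"
  then have p0: "p \<in> interior (Tri t [])" using open_triangle_interior by blast
  show "\<exists>q. Phi t `` {p} = {q}"
  proof (cases "\<exists>w. p \<in> frontier (Tri t w)")
    case True
    \<comment> \<open>A shortest word whose triangle has \<open>p\<close> on its boundary.\<close>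
    define w where "w = arg_min length (\<lambda>w. p \<in> frontier (Tri t w))"
    have w: "p \<in> frontier (Tri t w)" and first: "\<And>v. length v < length w \<Longrightarrow> p \<notin> frontier (Tri t v)"
      using True arg_min_natI[of "\<lambda>w. p \<in> frontier (Tri t w)"]
        arg_min_nat_le[of "\<lambda>w. p \<in> frontier (Tri t w)" _ length]
      unfolding w_def by (auto simp: not_le[symmetric])
    obtain f where f: "affine_map f" "\<And>j. f (vertex (F_prod t w) j) = vertex (G_prod t w) j"
      using affine_map_F_G_exists by blast
    have "w \<noteq> []" using w p0 by (auto simp: frontier_Tri)
    \<comment> \<open>This excludes the first clause of \<open>Phi\<close>: a triangle of level
      \<open>length w\<close> with \<open>p\<close> in its interior would have to be that of
      \<open>w\<close>, which has \<open>p\<close> on its boundary.\<close>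
    have "\<not> (\<forall>n\<ge>1. p \<in> interior (Tri t (prefix_word i n)))" for i
    proof
      assume "\<forall>n\<ge>1. p \<in> interior (Tri t (prefix_word i n))"
      then have i: "p \<in> interior (Tri t (prefix_word i (length w)))"
        using \<open>w \<noteq> []\<close> by (simp add: Suc_le_eq)
      then have "prefix_word i (length w) = w"
        using Tri_Int_interior w by (auto simp: frontier_Tri prefix_word_simps)
      with i w show False by (simp add: frontier_Tri)
    qed
    moreover have "g p = f p" if "p \<in> frontier (Tri t w')"
      "\<forall>v. length v < length w' \<longrightarrow> p \<notin> frontier (Tri t v)" "affine_map g"
      "\<forall>j. g (vertex (F_prod t w') j) = vertex (G_prod t w') j" for g w'
    proof -
      \<comment> \<open>Both words are of the first level at which \<open>p\<close> meets a
        boundary.\<close>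
      have "length w = length w'" using that(1,2) w first by (meson linorder_neqE_nat)
      then show ?thesis
        using affine_maps_agree_on_frontier[of f w g w' p] f that w first by simp
    qed
    ultimately have "(p, q) \<in> Phi t \<longleftrightarrow> q = f p" for q
      using p f w first unfolding Phi_def by blast
    then show ?thesis by (intro exI[of _ "f p"]) auto
  next
    case False
    then obtain i where i: "\<And>n. p \<in> interior (Tri t (prefix_word i n))"
      using interior_sequence_exists p0 interior_subset by blast
    \<comment> \<open>Off all boundaries the address is unique, so the first clause of
      \<open>Phi\<close> yields a single limit set.\<close>
    have "i' = i" if "\<forall>n\<ge>1. p \<in> interior (Tri t (prefix_word i' n))" for i'
    proof
      fix n
      have "p \<in> interior (Tri t (prefix_word i' (Suc n)))" using that by simp
      then have "prefix_word i' (Suc n) = prefix_word i (Suc n)"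
        using i[of "Suc n"] interior_subset
        by (intro Tri_Int_interior[of _ _ p]) (auto simp: prefix_word_simps(3))
      then show "i' n = i n" by (simp add: prefix_word_simps)
    qed
    then have "(p, q) \<in> Phi t \<longleftrightarrow> q \<in> Gam_limit t i" for q
      using p i False unfolding Phi_def by blast
    then have "Phi t `` {p} = Gam_limit t i" by auto
    then show ?thesis using Gam_limit_singleton[OF assms] by simp
  qed
qed

end

theorem mainTheorem7:
  fixes \<sigma> \<tau>0 \<tau>1 :: mat3
  assumes "(\<sigma>, \<tau>0, \<tau>1) \<in> trip_class (p_e, p_e, p23)
         \<or> (\<sigma>, \<tau>0, \<tau>1) \<in> trip_class (p_e, p_e, p132)
         \<or> (\<sigma>, \<tau>0, \<tau>1) \<in> trip_class (p_e, p23, p132)"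
  shows "(\<forall>i :: nat \<Rightarrow> bool. \<exists>q. Gam_limit (\<sigma>, \<tau>0, \<tau>1) i = {q})
         \<and> Phi_is_function (\<sigma>, \<tau>0, \<tau>1)"
proof -
  have "permutes_trip (p_e, p_e, p23)" "permutes_trip (p_e, p_e, p132)"
    "permutes_trip (p_e, p23, p132)"
    by (auto intro: S3_permutes_columns simp: S3_def)
  then have inv: "permutes_trip (\<sigma>, \<tau>0, \<tau>1) \<and> contracts (\<sigma>, \<tau>0, \<tau>1)"
    using assms trip_class_invariant contracts_representatives by blast
  then interpret permuted_subdivision \<sigma> \<tau>0 \<tau>1
    by unfold_locales auto
  show ?thesis using inv Gam_limit_singleton Phi_functional by blast
qed

end
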